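(* There is no locally dually flat proper doubly warped product Finsler manifold; that is, if $({}_{f_2}M_1\times_{f_1}M_2,F)$ is a doubly warped product Finsler manifold with neither $f_1$ nor $f_2$ constant, then $F$ is not locally dually flat.
   Context: A Finsler metric on a smooth manifold $N$ is a function $F:TN\to[0,\infty)$ that is $C^\infty$ off the zero section, positively 1-homogeneous on fibers, and whose fundamental tensor $g_{ij}=\frac12\frac{\partial^2F^2}{\partial y^i\partial y^j}$ is positive definite at every nonzero $y$, where $(x^i,y^i)$ are standard coordinates on $TN$. Doubly warped product (DWP): given Finsler manifolds $(M_1,F_1)$, $(M_2,F_2)$ and smooth functions $f_1:M_1\to\mathbb{R}^+$, $f_2:M_2\to\mathbb{R}^+$, the DWP-Finsler manifold $({}_{f_2}M_1\times_{f_1}M_2,F)$ is $M_1\times M_2$ with $F(v_1,v_2)=\sqrt{f_2^2(\pi_2(v_2))F_1^2(v_1)+f_1^2(\pi_1(v_1))F_2^2(v_2)}$, where $\pi_1,\pi_2$ denote the base points in $M_1,M_2$. $F$ is considered on $TM_1^\circ\times TM_2^\circ$, where $TM_i^\circ=TM_i\setminus\{0\}$. The DWP is proper if neither $f_1$ nor $f_2$ is constant. A Finsler metric $F=F(x,y)$ on a manifold is locally dually flat if at any point there is a standard coordinate system $(x^i,y^i)$ in the tangent bundle such that $\frac{\partial^2F^2}{\partial x^k\partial y^l}y^k=2\frac{\partial F^2}{\partial x^l}$.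
   Formalization: Standard coordinates on the product are restricted to those induced by a chart of M1 and a chart of M2; with mixed charts the claim fails (v²du²+u²dv² on the positive quadrant is flat). M1 and M2 are taken connected, since otherwise a locally constant nonconstant warping is a counterexample. *)

theory Defs
  imports "HOL-Analysis.Analysis"
begin

text \<open>\<open>C_k_on k S f\<close> is meant for open \<open>S\<close>: all iterated directional derivatives of \<open>f\<close> up to
  order \<open>k\<close> exist on \<open>S\<close> (as Frechet derivatives) and are continuous.\<close>

primrec C_k_on ::
  "nat \<Rightarrow> 'a::real_normed_vector set \<Rightarrow> ('a \<Rightarrow> 'b::real_normed_vector) \<Rightarrow> bool" where
  "C_k_on 0 S f \<longleftrightarrow> continuous_on S f"
| "C_k_on (Suc k) S f \<longleftrightarrow> (\<forall>x\<in>S. f differentiable (at x)) \<and>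
     (\<forall>v. C_k_on k S (\<lambda>x. frechet_derivative f (at x) v))"

definition smooth_on ::
  "'a::real_normed_vector set \<Rightarrow> ('a \<Rightarrow> 'b::real_normed_vector) \<Rightarrow> bool" where
  "smooth_on S f \<longleftrightarrow> (\<forall>k. C_k_on k S f)"

text \<open>A chart is a pair of its domain and its coordinate map; the values of the coordinate map
  outside the domain are irrelevant.  The dimension is \<open>DIM('e)\<close>.\<close>

type_synonym ('a, 'e) chart = "'a set \<times> ('a \<Rightarrow> 'e)"

definition chart_inv :: "('a, 'e) chart \<Rightarrow> 'e \<Rightarrow> 'a" where
  "chart_inv c = inv_into (fst c) (snd c)"

definition chart_of :: "'a topology \<Rightarrow> ('a, 'e::euclidean_space) chart \<Rightarrow> bool" where
  "chart_of X c \<longleftrightarrow> openin X (fst c) \<and> open (snd c ` fst c) \<and>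
     homeomorphic_map (subtopology X (fst c)) (top_of_set (snd c ` fst c)) (snd c)"

definition coord_change :: "('a, 'e) chart \<Rightarrow> ('a, 'e) chart \<Rightarrow> 'e \<Rightarrow> 'e" where
  "coord_change c d = snd d \<circ> chart_inv c"

definition compatible ::
  "('a, 'e::euclidean_space) chart \<Rightarrow> ('a, 'e) chart \<Rightarrow> bool" where
  "compatible c d \<longleftrightarrow>
     smooth_on (snd c ` (fst c \<inter> fst d)) (coord_change c d) \<and>
     smooth_on (snd d ` (fst c \<inter> fst d)) (coord_change d c)"

text \<open>Manifolds are taken to be connected; on a disconnected one, a warping function could be
  locally constant without being constant.\<close>

definition smooth_manifold ::
  "'a topology \<Rightarrow> ('a, 'e::euclidean_space) chart set \<Rightarrow> bool" where
  "smooth_manifold X A \<longleftrightarrow>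
     Hausdorff_space X \<and> second_countable X \<and> connected_space X \<and>
     (\<Union>c\<in>A. fst c) = topspace X \<and>
     (\<forall>c\<in>A. chart_of X c) \<and> (\<forall>c\<in>A. \<forall>d\<in>A. compatible c d) \<and>
     (\<forall>c. chart_of X c \<and> (\<forall>d\<in>A. compatible c d) \<longrightarrow> c \<in> A)"

definition smooth_real_fun ::
  "('a, 'e::euclidean_space) chart set \<Rightarrow> ('a \<Rightarrow> real) \<Rightarrow> bool" where
  "smooth_real_fun A f \<longleftrightarrow> (\<forall>c\<in>A. smooth_on (snd c ` fst c) (f \<circ> chart_inv c))"

text \<open>A tangent vector is a base point \<open>p\<close> together with its component vectors in all charts
  around \<open>p\<close>, which transform by the derivatives of the coordinate changes.  The components
  with respect to all other charts are set to \<open>0\<close>, so that equality is the intended one.\<close>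

type_synonym ('a, 'e) tvec = "'a \<times> (('a, 'e) chart \<Rightarrow> 'e)"

definition tangent_bundle ::
  "('a, 'e::euclidean_space) chart set \<Rightarrow> ('a, 'e) tvec set" where
  "tangent_bundle A = {(p, v). p \<in> (\<Union>c\<in>A. fst c) \<and>
     (\<forall>c\<in>A. \<forall>d\<in>A. p \<in> fst c \<inter> fst d \<longrightarrow>
        v d = frechet_derivative (coord_change c d) (at (snd c p)) (v c)) \<and>
     (\<forall>c. \<not> (c \<in> A \<and> p \<in> fst c) \<longrightarrow> v c = 0)}"

definition slit_tangent_bundle ::
  "('a, 'e::euclidean_space) chart set \<Rightarrow> ('a, 'e) tvec set" where
  "slit_tangent_bundle A = {w \<in> tangent_bundle A. snd w \<noteq> (\<lambda>_. 0)}"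

definition scale_tvec :: "real \<Rightarrow> ('a, 'e::euclidean_space) tvec \<Rightarrow> ('a, 'e) tvec" where
  "scale_tvec r w = (fst w, \<lambda>c. r *\<^sub>R snd w c)"

text \<open>The domain of a coordinate system on tangent vectors and the map \<open>w \<mapsto> (x, y)\<close>.\<close>

type_synonym ('t, 'e) tcoords = "'t set \<times> ('t \<Rightarrow> 'e \<times> 'e)"

definition std_coords ::
  "('a, 'e::euclidean_space) chart set \<Rightarrow> ('a, 'e) chart \<Rightarrow> (('a, 'e) tvec, 'e) tcoords" where
  "std_coords A c =
     ({w \<in> tangent_bundle A. fst w \<in> fst c}, \<lambda>w. (snd c (fst w), snd w c))"

definition local_expr :: "('t, 'e) tcoords \<Rightarrow> ('t \<Rightarrow> real) \<Rightarrow> 'e \<times> 'e \<Rightarrow> real" where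
  "local_expr s F = F \<circ> inv_into (fst s) (snd s)"

text \<open>\<open>\<partial>/\<partial>x\<^sup>k\<close> and \<open>\<partial>/\<partial>y\<^sup>k\<close>, where \<open>k\<close> is a vector of the standard basis.\<close>

definition dx :: "'e::euclidean_space \<Rightarrow> ('e \<times> 'e \<Rightarrow> real) \<Rightarrow> 'e \<times> 'e \<Rightarrow> real" where
  "dx k L z = deriv (\<lambda>t::real. L (z + t *\<^sub>R (k, 0))) 0"

definition dy :: "'e::euclidean_space \<Rightarrow> ('e \<times> 'e \<Rightarrow> real) \<Rightarrow> 'e \<times> 'e \<Rightarrow> real" where
  "dy k L z = deriv (\<lambda>t::real. L (z + t *\<^sub>R (0, k))) 0"

definition fundamental_tensor ::
  "('e \<times> 'e \<Rightarrow> real) \<Rightarrow> 'e::euclidean_space \<Rightarrow> 'e \<Rightarrow> 'e \<times> 'e \<Rightarrow> real" where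
  "fundamental_tensor L i j z = 1 / 2 * dy i (dy j (\<lambda>z. (L z)\<^sup>2)) z"

definition finsler_metric ::
  "('a, 'e::euclidean_space) chart set \<Rightarrow> (('a, 'e) tvec \<Rightarrow> real) \<Rightarrow> bool" where
  "finsler_metric A F \<longleftrightarrow>
     (\<forall>w\<in>tangent_bundle A. 0 \<le> F w) \<and>
     (\<forall>w\<in>tangent_bundle A. \<forall>r>0. F (scale_tvec r w) = r * F w) \<and>
     (\<forall>c\<in>A. let s = std_coords A c; D = snd s ` (fst s \<inter> slit_tangent_bundle A) in
        smooth_on D (local_expr s F) \<and>
        (\<forall>z\<in>D. \<forall>\<eta>. \<eta> \<noteq> 0 \<longrightarrow>
           0 < (\<Sum>i\<in>Basis. \<Sum>j\<in>Basis.
                  fundamental_tensor (local_expr s F) i j z * (\<eta> \<bullet> i) * (\<eta> \<bullet> j))))"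

definition finsler_manifold ::
  "'a topology \<Rightarrow> ('a, 'e::euclidean_space) chart set \<Rightarrow> (('a, 'e) tvec \<Rightarrow> real) \<Rightarrow> bool" where
  "finsler_manifold X A F \<longleftrightarrow> smooth_manifold X A \<and> finsler_metric A F"

text \<open>\<open>T\<close> is the set of tangent vectors on which \<open>F\<close> is considered, and \<open>S\<close> is the set of standard
  coordinate systems.  As \<open>S\<close> consists of coordinate systems whose domains contain whole fibers,
  quantifying over \<open>T\<close> amounts to quantifying over base points.\<close>

definition locally_dually_flat ::
  "'t set \<Rightarrow> ('t, 'e::euclidean_space) tcoords set \<Rightarrow> ('t \<Rightarrow> real) \<Rightarrow> bool" where
  "locally_dually_flat T S F \<longleftrightarrow>
     (\<forall>w\<in>T. \<exists>s\<in>S. w \<in> fst s \<and>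
        (let L = (\<lambda>z. (local_expr s F z)\<^sup>2) in
         \<forall>z \<in> snd s ` (fst s \<inter> T). \<forall>l\<in>Basis.
           (\<Sum>k\<in>Basis. dx k (dy l L) z * (snd z \<bullet> k)) = 2 * dx l L z))"

text \<open>\<open>T(M\<^sub>1 \<times> M\<^sub>2)\<close> is identified with \<open>TM\<^sub>1 \<times> TM\<^sub>2\<close>.  Its standard coordinates are the
  coordinates \<open>((x, u), (y, v))\<close> induced by charts \<open>x\<close> of \<open>M\<^sub>1\<close> and \<open>u\<close> of \<open>M\<^sub>2\<close>.  Coordinates of
  \<open>M\<^sub>1 \<times> M\<^sub>2\<close> mixing the factors are not meant: the proper doubly warped product
  \<open>v\<^sup>2 du\<^sup>2 + u\<^sup>2 dv\<^sup>2\<close> on the positive quadrant is a flat Riemannian metric, which satisfies the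
  equations of dual flatness in Cartesian coordinates.\<close>

definition prod_coords ::
  "('t1, 'e1) tcoords \<Rightarrow> ('t2, 'e2) tcoords \<Rightarrow> ('t1 \<times> 't2, 'e1 \<times> 'e2) tcoords" where
  "prod_coords s1 s2 = (fst s1 \<times> fst s2,
     \<lambda>(w1, w2). ((fst (snd s1 w1), fst (snd s2 w2)), (snd (snd s1 w1), snd (snd s2 w2))))"

definition dwp_std_coords ::
  "('a, 'm::euclidean_space) chart set \<Rightarrow> ('b, 'n::euclidean_space) chart set \<Rightarrow>
   (('a, 'm) tvec \<times> ('b, 'n) tvec, 'm \<times> 'n) tcoords set" where
  "dwp_std_coords A1 A2 =
     {prod_coords (std_coords A1 c1) (std_coords A2 c2) |c1 c2. c1 \<in> A1 \<and> c2 \<in> A2}"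

definition dwp_metric ::
  "('b \<Rightarrow> real) \<Rightarrow> (('a, 'm) tvec \<Rightarrow> real) \<Rightarrow> ('a \<Rightarrow> real) \<Rightarrow> (('b, 'n) tvec \<Rightarrow> real) \<Rightarrow>
   ('a, 'm) tvec \<times> ('b, 'n) tvec \<Rightarrow> real" where
  "dwp_metric f2 F1 f1 F2 =
     (\<lambda>(v1, v2). sqrt ((f2 (fst v2))\<^sup>2 * (F1 v1)\<^sup>2 + (f1 (fst v1))\<^sup>2 * (F2 v2)\<^sup>2))"

definition warping_function ::
  "'a topology \<Rightarrow> ('a, 'e::euclidean_space) chart set \<Rightarrow> ('a \<Rightarrow> real) \<Rightarrow> bool" where
  "warping_function X A f \<longleftrightarrow> smooth_real_fun A f \<and> (\<forall>p\<in>topspace X. 0 < f p)"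

end

theory Submission
  imports Defs
begin

text \<open>
  In the induced coordinates \<open>((x, u), (y, v))\<close> the square of the metric is
  \<open>f\<^sub>2(u)\<^sup>2 G(x, y) + f\<^sub>1(x)\<^sup>2 H(u, v)\<close>, where \<open>H\<close> is homogeneous of degree 2 in \<open>v\<close>.  Take the equation
  of dual flatness for an index \<open>i\<close> of the first factor and replace \<open>v\<close> by \<open>r v\<close> with \<open>r > 0\<close>: its left
  side is affine in \<open>r\<close>, and its right side is a constant plus \<open>2 r\<^sup>2 (\<partial>\<^sub>i f\<^sub>1\<^sup>2)(x) H(u, v)\<close>.  Hence
  \<open>(\<partial>\<^sub>i f\<^sub>1\<^sup>2)(x) H(u, v) = 0\<close>.  As the fundamental tensor is positive definite, \<open>H(u, v) \<noteq> 0\<close> for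
  some \<open>v\<close>, so \<open>f\<^sub>1\<close> is locally constant, and constant by connectedness.
\<close>

section \<open>Charts and the derivatives of coordinate changes\<close>

lemma smooth_on_differentiable:
  assumes "smooth_on S f" "x \<in> S"
  shows "f differentiable (at x)"
  using assms C_k_on.simps(2)[of 0 S f] unfolding smooth_on_def by blast

lemma smooth_manifold_chart:
  assumes "smooth_manifold X A" "c \<in> A"
  shows "chart_of X c"
  using assms by (auto simp: smooth_manifold_def)

lemma chart_subset: "chart_of X c \<Longrightarrow> fst c \<subseteq> topspace X"
  by (simp add: chart_of_def openin_subset)

lemma chart_inj:
  assumes "chart_of X c"
  shows "inj_on (snd c) (fst c)"
  using assms chart_subset[OF assms]
  by (auto simp: chart_of_def Int_absorb1 dest!: homeomorphic_imp_injective_map)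

lemma chart_inv_eq:
  assumes "chart_of X c" "p \<in> fst c"
  shows "chart_inv c (snd c p) = p"
  using chart_inj[OF assms(1)] assms(2) by (simp add: chart_inv_def)

text \<open>A chart is an open map onto its image, and that image is itself open, so relative
  openness becomes openness.\<close>

lemma chart_image_open:
  assumes c: "chart_of X c" and U: "openin X U"
  shows "open (snd c ` (fst c \<inter> U))"
proof -
  have "open_map (subtopology X (fst c)) (top_of_set (snd c ` fst c)) (snd c)"
    using c by (auto simp: chart_of_def intro: homeomorphic_imp_open_map)
  moreover have "openin (subtopology X (fst c)) (fst c \<inter> U)"
    using U by (auto simp: openin_subtopology)
  ultimately have "openin (top_of_set (snd c ` fst c)) (snd c ` (fst c \<inter> U))"
    by (auto simp: open_map_def)
  then show ?thesis
    using c by (auto simp: chart_of_def openin_open_eq)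
qed

text \<open>Continuity of the chart gives openness relative to \<open>fst c\<close>, which is open
  in \<open>X\<close>. Small balls in coordinates thereby become neighbourhoods in the
  manifold.\<close>

lemma chart_preimage_open:
  assumes c: "chart_of X c" and B: "open B"
  shows "openin X {p \<in> fst c. snd c p \<in> B}"
proof -
  have "continuous_map (subtopology X (fst c)) (top_of_set (snd c ` fst c)) (snd c)"
    using c by (auto simp: chart_of_def intro: homeomorphic_imp_continuous_map)
  then have "continuous_map (subtopology X (fst c)) euclidean (snd c)"
    by (simp add: continuous_map_in_subtopology)
  then have "openin (subtopology X (fst c)) {p \<in> topspace (subtopology X (fst c)). snd c p \<in> B}"
    using B by (intro openin_continuous_map_preimage) auto
  moreover have "{p \<in> topspace (subtopology X (fst c)). snd c p \<in> B} = {p \<in> fst c. snd c p \<in> B}"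
    using chart_subset[OF c] by auto
  ultimately show ?thesis
    using c openin_trans_full unfolding chart_of_def by metis
qed

lemma coord_change_differentiable:
  assumes "smooth_manifold X A" "c \<in> A" "d \<in> A" "p \<in> fst c" "p \<in> fst d"
  shows "coord_change c d differentiable (at (snd c p))"
proof (rule smooth_on_differentiable)
  show "smooth_on (snd c ` (fst c \<inter> fst d)) (coord_change c d)"
    using assms by (auto simp: smooth_manifold_def compatible_def)
qed (use assms in auto)

text \<open>\<open>coord_change c c\<close> is the identity on the chart image only; as this image
  is open, the derivative there is still the identity.\<close>

lemma coord_change_derivative_id:
  assumes M: "smooth_manifold X A" and c: "c \<in> A" and p: "p \<in> fst c"
  shows "frechet_derivative (coord_change c c) (at (snd c p)) = (\<lambda>y. y)"
proof -
  have ch: "chart_of X c"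
    using smooth_manifold_chart[OF M c] .
  have "(coord_change c c has_derivative (\<lambda>y. y)) (at (snd c p))"
  proof (rule has_derivative_transform_within_open[OF has_derivative_ident])
    show "open (snd c ` fst c)"
      using ch by (simp add: chart_of_def)
  qed (use p in \<open>auto simp: coord_change_def chart_inv_eq[OF ch]\<close>)
  then show ?thesis
    by (rule frechet_derivative_at[symmetric])
qed

text \<open>This is the cocycle identity, obtained from the chain rule. The change from
  \<open>c\<close> to \<open>e\<close> factors through \<open>d\<close> on the image of the overlap
  of \<open>c\<close> and \<open>d\<close>, an open neighbourhood of \<open>snd c p\<close>.\<close>

lemma coord_change_derivative_compose:
  assumes M: "smooth_manifold X A" and A: "c \<in> A" "d \<in> A" "e \<in> A"
    and p: "p \<in> fst c" "p \<in> fst d" "p \<in> fst e"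
  shows "frechet_derivative (coord_change c e) (at (snd c p)) y =
    frechet_derivative (coord_change d e) (at (snd d p))
      (frechet_derivative (coord_change c d) (at (snd c p)) y)"
proof -
  have ch: "chart_of X c" "chart_of X d"
    using smooth_manifold_chart[OF M] A by auto
  let ?f = "frechet_derivative (coord_change c d) (at (snd c p))"
  let ?g = "frechet_derivative (coord_change d e) (at (snd d p))"
  have f: "(coord_change c d has_derivative ?f) (at (snd c p))"
    using coord_change_differentiable[OF M A(1,2) p(1,2)] by (simp add: frechet_derivative_works)
  have g: "(coord_change d e has_derivative ?g) (at (coord_change c d (snd c p)))"
    using coord_change_differentiable[OF M A(2,3) p(2,3)] p
    by (simp add: frechet_derivative_works coord_change_def chart_inv_eq[OF ch(1)])
  have "(coord_change c e has_derivative (?g \<circ> ?f)) (at (snd c p))"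
  proof (rule has_derivative_transform_within_open[OF diff_chain_at[OF f g]])
    show "open (snd c ` (fst c \<inter> fst d))"
      using ch by (intro chart_image_open) (auto simp: chart_of_def)
  qed (use p in \<open>auto simp: coord_change_def chart_inv_eq[OF ch(1)] chart_inv_eq[OF ch(2)]\<close>)
  from frechet_derivative_at[OF this] show ?thesis
    by (metis comp_apply)
qed

section \<open>Tangent vectors determined by their components in one chart\<close>

text \<open>For \<open>c\<close> in the atlas, this inverts the standard coordinates of
  \<open>c\<close>: it is the tangent vector at \<open>p\<close> with component \<open>y\<close> in
  \<open>c\<close>. The value \<open>0\<close> in the remaining charts follows the convention of
  \<open>tangent_bundle\<close>.\<close>

definition tvec_of ::
  "('a, 'e::euclidean_space) chart set \<Rightarrow> ('a, 'e) chart \<Rightarrow> 'a \<Rightarrow> 'e \<Rightarrow> ('a, 'e) tvec" where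
  "tvec_of A c p y = (p, \<lambda>d. if d \<in> A \<and> p \<in> fst d
     then frechet_derivative (coord_change c d) (at (snd c p)) y else 0)"

lemma tangent_bundle_iff:
  "w \<in> tangent_bundle A \<longleftrightarrow> fst w \<in> (\<Union>c\<in>A. fst c) \<and>
    (\<forall>c\<in>A. \<forall>d\<in>A. fst w \<in> fst c \<inter> fst d \<longrightarrow>
      snd w d = frechet_derivative (coord_change c d) (at (snd c (fst w))) (snd w c)) \<and>
    (\<forall>c. \<not> (c \<in> A \<and> fst w \<in> fst c) \<longrightarrow> snd w c = 0)"
  by (simp only: tangent_bundle_def mem_Collect_eq case_prod_unfold)

text \<open>The transformation law between two charts \<open>d\<close> and \<open>e\<close> is the
  cocycle identity for the passage from \<open>c\<close> through \<open>d\<close> to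
  \<open>e\<close>.\<close>

lemma tvec_of_in_tangent_bundle:
  assumes "smooth_manifold X A" "c \<in> A" "p \<in> fst c"
  shows "tvec_of A c p y \<in> tangent_bundle A"
  unfolding tangent_bundle_iff
proof (intro conjI ballI allI impI)
  let ?w = "tvec_of A c p y"
  have w: "snd ?w d = frechet_derivative (coord_change c d) (at (snd c p)) y"
    if "d \<in> A" "p \<in> fst d" for d
    using that by (simp add: tvec_of_def)
  show "fst ?w \<in> (\<Union>c\<in>A. fst c)"
    using assms(2,3) by (auto simp: tvec_of_def)
  fix d e
  assume d: "d \<in> A" and e: "e \<in> A" and "fst ?w \<in> fst d \<inter> fst e"
  then have p: "p \<in> fst d" "p \<in> fst e"
    by (simp_all add: tvec_of_def)
  show "snd ?w e = frechet_derivative (coord_change d e) (at (snd d (fst ?w))) (snd ?w d)"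
    unfolding w[OF d p(1)] w[OF e p(2)] unfolding tvec_of_def fst_conv
    by (rule coord_change_derivative_compose[OF assms(1,2) d e assms(3) p])
next
  fix d
  assume "\<not> (d \<in> A \<and> fst (tvec_of A c p y) \<in> fst d)"
  then show "snd (tvec_of A c p y) d = 0"
    by (auto simp: tvec_of_def)
qed

lemma fst_tvec_of [simp]: "fst (tvec_of A c p y) = p"
  by (simp add: tvec_of_def)

lemma snd_tvec_of:
  assumes "smooth_manifold X A" "c \<in> A" "p \<in> fst c"
  shows "snd (tvec_of A c p y) c = y"
  using assms coord_change_derivative_id[OF assms] by (simp add: tvec_of_def)

lemma tangent_vector_transform:
  assumes "w \<in> tangent_bundle A" "c \<in> A" "d \<in> A" "fst w \<in> fst c" "fst w \<in> fst d"
  shows "snd w d = frechet_derivative (coord_change c d) (at (snd c (fst w))) (snd w c)"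
  using assms unfolding tangent_bundle_iff by blast

lemma tangent_vector_zero:
  assumes "w \<in> tangent_bundle A" "\<not> (c \<in> A \<and> fst w \<in> fst c)"
  shows "snd w c = 0"
  using assms unfolding tangent_bundle_iff by blast

text \<open>The transformation law carries the component in \<open>c\<close> to every other chart
  around the point, and the components in all remaining charts are \<open>0\<close> by
  convention.\<close>

lemma tangent_vector_eqI:
  assumes w: "w \<in> tangent_bundle A" "w' \<in> tangent_bundle A"
    and c: "c \<in> A" "fst w \<in> fst c" "fst w' = fst w" "snd w c = snd w' c"
  shows "w = w'"
proof -
  have "snd w d = snd w' d" for d
  proof (cases "d \<in> A \<and> fst w \<in> fst d")
    case True
    then show ?thesis
      using tangent_vector_transform[OF w(1) c(1), of d] tangent_vector_transform[OF w(2) c(1), of d] c(2-4)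
      by simp
  next
    case False
    then show ?thesis
      using tangent_vector_zero w c(3) by metis
  qed
  then show ?thesis
    using c(3) by (simp add: prod_eq_iff fun_eq_iff)
qed

section \<open>Standard coordinates on the tangent bundle and its slit part\<close>

lemma fst_std_coords: "fst (std_coords A c) = {w \<in> tangent_bundle A. fst w \<in> fst c}"
  by (simp add: std_coords_def)

lemma snd_std_coords: "snd (std_coords A c) w = (snd c (fst w), snd w c)"
  by (simp add: std_coords_def)

lemma std_coords_inj:
  assumes "smooth_manifold X A" "c \<in> A"
  shows "inj_on (snd (std_coords A c)) (fst (std_coords A c))"
proof (rule inj_onI)
  fix w w'
  assume w: "w \<in> fst (std_coords A c)" "w' \<in> fst (std_coords A c)"
    "snd (std_coords A c) w = snd (std_coords A c) w'"
  then have "fst w' = fst w"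
    using chart_inj[OF smooth_manifold_chart[OF assms]]
    by (auto simp: fst_std_coords snd_std_coords inj_on_def)
  then show "w = w'"
    using w assms(2) by (intro tangent_vector_eqI[of _ A _ c]) (auto simp: fst_std_coords snd_std_coords)
qed

text \<open>Derivatives of coordinate changes are linear, so a component vanishing in one chart
  vanishes in all of them.\<close>

lemma slit_tangent_bundle_iff:
  assumes M: "smooth_manifold X A" and c: "c \<in> A" "fst w \<in> fst c" and w: "w \<in> tangent_bundle A"
  shows "w \<in> slit_tangent_bundle A \<longleftrightarrow> snd w c \<noteq> 0"
proof -
  have "snd w d = 0" if 0: "snd w c = 0" for d
  proof (cases "d \<in> A \<and> fst w \<in> fst d")
    case True
    then have "snd w d = frechet_derivative (coord_change c d) (at (snd c (fst w))) (snd w c)"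
      using w c tangent_vector_transform by blast
    then show ?thesis
      using 0 coord_change_differentiable[OF M c(1) _ c(2)] True
      by (simp add: linear_0 linear_frechet_derivative)
  next
    case False
    then show ?thesis
      using w tangent_vector_zero by blast
  qed
  then have "snd w c = 0 \<Longrightarrow> snd w = (\<lambda>_. 0)"
    by (intro ext)
  then show ?thesis
    using w by (auto simp: slit_tangent_bundle_def)
qed

text \<open>Every nonzero \<open>y\<close> over a chart point is attained, by
  \<open>tvec_of\<close>. The smoothness and positivity conditions on a Finsler metric thus become
  conditions on an explicit product set.\<close>

lemma std_coords_slit_image:
  assumes M: "smooth_manifold X A" and c: "c \<in> A"
  shows "snd (std_coords A c) ` (fst (std_coords A c) \<inter> slit_tangent_bundle A) =
    (snd c ` fst c) \<times> (- {0})"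
proof (intro equalityI subsetI)
  fix z
  assume "z \<in> snd (std_coords A c) ` (fst (std_coords A c) \<inter> slit_tangent_bundle A)"
  then show "z \<in> (snd c ` fst c) \<times> (- {0})"
    using slit_tangent_bundle_iff[OF M c] by (auto simp: fst_std_coords snd_std_coords)
next
  fix z :: "'b \<times> 'b"
  assume "z \<in> (snd c ` fst c) \<times> (- {0})"
  then obtain p y where z: "z = (snd c p, y)" "p \<in> fst c" "y \<noteq> 0"
    by auto
  have "tvec_of A c p y \<in> fst (std_coords A c) \<inter> slit_tangent_bundle A"
    using z slit_tangent_bundle_iff[OF M c, of "tvec_of A c p y"]
    by (simp add: fst_std_coords tvec_of_in_tangent_bundle[OF M c] snd_tvec_of[OF M c])
  then show "z \<in> snd (std_coords A c) ` (fst (std_coords A c) \<inter> slit_tangent_bundle A)"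
    using z by (intro image_eqI[of _ _ "tvec_of A c p y"]) (auto simp: snd_std_coords snd_tvec_of[OF M c])
qed

text \<open>Since \<open>local_expr\<close> is built from \<open>inv_into\<close>, injectivity of
  the coordinates is what makes it return the value at \<open>w\<close> itself.\<close>

lemma local_expr_eq:
  assumes "inj_on (snd s) (fst s)" "w \<in> fst s"
  shows "local_expr s F (snd s w) = F w"
  using assms by (simp add: local_expr_def)

lemma local_expr_tvec_of:
  assumes M: "smooth_manifold X A" and c: "c \<in> A" "p \<in> fst c"
  shows "local_expr (std_coords A c) F (snd c p, y) = F (tvec_of A c p y)"
  using local_expr_eq[OF std_coords_inj[OF M c(1)], of "tvec_of A c p y" F] c
  by (simp add: fst_std_coords snd_std_coords tvec_of_in_tangent_bundle[OF M c] snd_tvec_of[OF M c])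

lemma scale_tvec_of:
  assumes M: "smooth_manifold X A" and c: "c \<in> A" "p \<in> fst c"
  shows "scale_tvec r (tvec_of A c p y) = tvec_of A c p (r *\<^sub>R y)"
proof -
  have "frechet_derivative (coord_change c d) (at (snd c p)) (r *\<^sub>R y) =
      r *\<^sub>R frechet_derivative (coord_change c d) (at (snd c p)) y" if "d \<in> A" "p \<in> fst d" for d
    using linear_frechet_derivative[OF coord_change_differentiable[OF M c(1) that(1) c(2) that(2)]]
    by (simp add: linear_scale)
  then show ?thesis
    by (auto simp: scale_tvec_def tvec_of_def)
qed

section \<open>The Finsler metric in local coordinates\<close>

text \<open>Scaling a tangent vector scales its component in \<open>c\<close> and keeps its base
  point, so homogeneity on fibers carries over to coordinates.\<close>

lemma local_expr_homogeneous:
  assumes F: "finsler_manifold X A F" and c: "c \<in> A" and x: "x \<in> snd c ` fst c" and r: "r > 0"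
  shows "local_expr (std_coords A c) F (x, r *\<^sub>R y) = r * local_expr (std_coords A c) F (x, y)"
proof -
  have M: "smooth_manifold X A"
    using F by (simp add: finsler_manifold_def)
  obtain p where p: "x = snd c p" "p \<in> fst c"
    using x by auto
  have "F (scale_tvec r (tvec_of A c p y)) = r * F (tvec_of A c p y)"
    using F r tvec_of_in_tangent_bundle[OF M c p(2)]
    by (simp add: finsler_manifold_def finsler_metric_def)
  then show ?thesis
    using p by (simp add: local_expr_tvec_of[OF M c p(2)] scale_tvec_of[OF M c p(2)])
qed

lemma finsler_local_differentiable:
  assumes F: "finsler_manifold X A F" and c: "c \<in> A"
    and z: "z \<in> (snd c ` fst c) \<times> (- {0})"
  shows "local_expr (std_coords A c) F differentiable (at z)"
proof (rule smooth_on_differentiable[OF _ z])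
  have M: "smooth_manifold X A"
    using F by (simp add: finsler_manifold_def)
  show "smooth_on ((snd c ` fst c) \<times> (- {0})) (local_expr (std_coords A c) F)"
    using F c std_coords_slit_image[OF M c]
    by (auto simp: finsler_manifold_def finsler_metric_def Let_def)
qed

lemma fundamental_tensor_pos:
  fixes A :: "('a, 'e::euclidean_space) chart set"
  assumes F: "finsler_manifold X A F" and c: "c \<in> A"
    and z: "z \<in> (snd c ` fst c) \<times> (- {0})" and \<eta>: "\<eta> \<noteq> 0"
  shows "0 < (\<Sum>i\<in>Basis. \<Sum>j\<in>Basis.
    fundamental_tensor (local_expr (std_coords A c) F) i j z * (\<eta> \<bullet> i) * (\<eta> \<bullet> j))"
proof -
  have M: "smooth_manifold X A"
    using F by (simp add: finsler_manifold_def)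
  have "z \<in> snd (std_coords A c) ` (fst (std_coords A c) \<inter> slit_tangent_bundle A)"
    using z by (simp only: std_coords_slit_image[OF M c])
  then show ?thesis
    using F c \<eta> unfolding finsler_manifold_def finsler_metric_def Let_def by blast
qed

section \<open>Partial derivatives as derivatives along lines\<close>

lemma eventually_line_in_open:
  fixes z k :: "'a::real_normed_vector"
  assumes "open D" "z \<in> D"
  shows "\<forall>\<^sub>F t::real in nhds 0. z + t *\<^sub>R k \<in> D"
proof (rule topological_tendstoD)
  show "((\<lambda>t::real. z + t *\<^sub>R k) \<longlongrightarrow> z + 0 *\<^sub>R k) (nhds 0)"
    by (intro tendsto_intros filterlim_ident)
qed (use assms in auto)

text \<open>A derivative along a line depends only on values near the point, and the line stays in
  the open set \<open>D\<close> for small parameters. A function may therefore be replaced by a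
  formula known only on \<open>D\<close>.\<close>

lemma dy_cong:
  assumes "open D" "z \<in> D" "\<And>z. z \<in> D \<Longrightarrow> f z = g z"
  shows "dy k f z = dy k g z"
  unfolding dy_def
  by (intro deriv_cong_ev eventually_mono[OF eventually_line_in_open[OF assms(1,2)]] assms(3) refl)

lemma dx_cong:
  assumes "open D" "z \<in> D" "\<And>z. z \<in> D \<Longrightarrow> f z = g z"
  shows "dx k f z = dx k g z"
  unfolding dx_def
  by (intro deriv_cong_ev eventually_mono[OF eventually_line_in_open[OF assms(1,2)]] assms(3) refl)

text \<open>The chain rule links the Frechet derivative, in which smoothness is expressed, to the
  one-variable derivatives that define \<open>dx\<close> and \<open>dy\<close>.\<close>

lemma has_field_derivative_along_line:
  fixes f :: "'a::real_normed_vector \<Rightarrow> real"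
  assumes "f differentiable (at z)"
  shows "((\<lambda>t. f (z + t *\<^sub>R k)) has_field_derivative frechet_derivative f (at z) k) (at 0)"
proof -
  have f: "(f has_derivative frechet_derivative f (at z)) (at (z + 0 *\<^sub>R k))"
    using assms by (simp add: frechet_derivative_works)
  have "((\<lambda>t::real. z + t *\<^sub>R k) has_derivative (\<lambda>t. t *\<^sub>R k)) (at 0)"
    by (auto intro!: derivative_eq_intros)
  from diff_chain_at[OF this f] show ?thesis
    unfolding has_field_derivative_def o_def
    by (simp add: linear_scale[OF linear_frechet_derivative[OF assms]] mult.commute[of _ "frechet_derivative f (at z) k"])
qed

text \<open>If the metric vanished on all nonzero vectors over \<open>x\<close>, its second
  derivatives in fiber directions would vanish there too, against positive definiteness of the
  fundamental tensor.\<close>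

lemma finsler_local_nonzero:
  fixes A :: "('a, 'e::euclidean_space) chart set"
  assumes F: "finsler_manifold X A F" and c: "c \<in> A" and x: "x \<in> snd c ` fst c"
  shows "\<exists>y. y \<noteq> 0 \<and> local_expr (std_coords A c) F (x, y) \<noteq> 0"
proof (rule ccontr)
  let ?L = "local_expr (std_coords A c) F"
  assume "\<not> ?thesis"
  then have 0: "?L (x, y) = 0" if "y \<noteq> 0" for y
    using that by blast
  have fiber: "\<forall>\<^sub>F t::real in nhds 0. y + t *\<^sub>R k \<noteq> 0" if "y \<noteq> 0" for y k :: 'e
    using eventually_line_in_open[of "- {0}" y k] that by (simp add: open_Compl)
  \<comment> \<open>The first derivative has to vanish at every nonzero \<open>y\<close>, not just
    at one, so that it can be differentiated again. Only \<open>y\<close> moves, so the base point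
    stays at \<open>x\<close>.\<close>
  have 1: "dy j (\<lambda>z. (?L z)\<^sup>2) (x, y) = 0" if "y \<noteq> 0" for y j
  proof -
    have "\<forall>\<^sub>F t::real in nhds 0. (?L ((x, y) + t *\<^sub>R (0, j)))\<^sup>2 = 0"
      using fiber[OF that, of j] by eventually_elim (simp add: 0)
    then have "dy j (\<lambda>z. (?L z)\<^sup>2) (x, y) = deriv (\<lambda>t::real. 0::real) 0"
      unfolding dy_def by (intro deriv_cong_ev) auto
    then show ?thesis
      by simp
  qed
  have 2: "dy i (dy j (\<lambda>z. (?L z)\<^sup>2)) (x, y) = 0" if "y \<noteq> 0" for y i j
  proof -
    have "\<forall>\<^sub>F t::real in nhds 0. dy j (\<lambda>z. (?L z)\<^sup>2) ((x, y) + t *\<^sub>R (0, i)) = 0"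
      using fiber[OF that, of i] by eventually_elim (simp add: 1)
    then have "dy i (dy j (\<lambda>z. (?L z)\<^sup>2)) (x, y) = deriv (\<lambda>t::real. 0::real) 0"
      unfolding dy_def[of i] by (intro deriv_cong_ev) auto
    then show ?thesis
      by simp
  qed
  \<comment> \<open>The same vector \<open>b\<close> serves as the point of the fiber and as the
    argument of the quadratic form.\<close>
  obtain b :: 'e where b: "b \<in> Basis"
    using nonempty_Basis by blast
  then have "b \<noteq> 0"
    using nonzero_Basis by blast
  then have "0 < (\<Sum>i\<in>Basis. \<Sum>j\<in>Basis. fundamental_tensor ?L i j (x, b) * (b \<bullet> i) * (b \<bullet> j))"
    using x by (intro fundamental_tensor_pos[OF F c]) auto
  then show False
    using 2[OF \<open>b \<noteq> 0\<close>] by (simp add: fundamental_tensor_def)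
qed

section \<open>The doubly warped metric in product coordinates\<close>

lemma prod_coords_inj:
  assumes "inj_on (snd s1) (fst s1)" "inj_on (snd s2) (fst s2)"
  shows "inj_on (snd (prod_coords s1 s2)) (fst (prod_coords s1 s2))"
  using assms by (auto simp: prod_coords_def inj_on_def prod_eq_iff)

text \<open>Squaring cancels the root because the radicand is a sum of squares. The vectors with
  components \<open>y\<close> and \<open>v\<close> are supplied by \<open>tvec_of\<close>, for zero
  components as well.\<close>

lemma local_expr_dwp:
  assumes M: "smooth_manifold X1 A1" "smooth_manifold X2 A2"
    and c: "c1 \<in> A1" "c2 \<in> A2"
    and x: "x \<in> snd c1 ` fst c1" "u \<in> snd c2 ` fst c2"
  shows "(local_expr (prod_coords (std_coords A1 c1) (std_coords A2 c2))
      (dwp_metric f2 F1 f1 F2) ((x, u), (y, v)))\<^sup>2 =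
    (f2 (chart_inv c2 u))\<^sup>2 * (local_expr (std_coords A1 c1) F1 (x, y))\<^sup>2 +
    (f1 (chart_inv c1 x))\<^sup>2 * (local_expr (std_coords A2 c2) F2 (u, v))\<^sup>2"
proof -
  let ?s = "prod_coords (std_coords A1 c1) (std_coords A2 c2)"
  obtain p q where p: "x = snd c1 p" "p \<in> fst c1" and q: "u = snd c2 q" "q \<in> fst c2"
    using x by auto
  let ?w = "(tvec_of A1 c1 p y, tvec_of A2 c2 q v)"
  have "snd ?s ?w = ((x, u), (y, v))"
    using p q by (simp add: prod_coords_def snd_std_coords snd_tvec_of[OF M(1) c(1)] snd_tvec_of[OF M(2) c(2)])
  moreover have "?w \<in> fst ?s"
    using p q by (simp add: prod_coords_def fst_std_coords tvec_of_in_tangent_bundle[OF M(1) c(1)]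
        tvec_of_in_tangent_bundle[OF M(2) c(2)])
  ultimately have "local_expr ?s (dwp_metric f2 F1 f1 F2) ((x, u), (y, v)) = dwp_metric f2 F1 f1 F2 ?w"
    using local_expr_eq[OF prod_coords_inj[OF std_coords_inj[OF M(1) c(1)] std_coords_inj[OF M(2) c(2)]],
        of ?w "dwp_metric f2 F1 f1 F2"] by simp
  then show ?thesis
    using p q by (simp add: dwp_metric_def local_expr_tvec_of[OF M(1) c(1)] local_expr_tvec_of[OF M(2) c(2)]
        chart_inv_eq[OF smooth_manifold_chart[OF M(1) c(1)]] chart_inv_eq[OF smooth_manifold_chart[OF M(2) c(2)]])
qed

lemma prod_coords_slit_image:
  assumes M: "smooth_manifold X1 A1" "smooth_manifold X2 A2"
    and c: "c1 \<in> A1" "c2 \<in> A2"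
    and x: "x \<in> snd c1 ` fst c1" "u \<in> snd c2 ` fst c2" and y: "y \<noteq> 0" "v \<noteq> 0"
  shows "((x, u), (y, v)) \<in> snd (prod_coords (std_coords A1 c1) (std_coords A2 c2)) `
    (fst (prod_coords (std_coords A1 c1) (std_coords A2 c2)) \<inter>
      slit_tangent_bundle A1 \<times> slit_tangent_bundle A2)"
proof -
  have "(x, y) \<in> snd (std_coords A1 c1) ` (fst (std_coords A1 c1) \<inter> slit_tangent_bundle A1)"
    using x y by (simp add: std_coords_slit_image[OF M(1) c(1)])
  then obtain w1 where w1: "w1 \<in> fst (std_coords A1 c1)" "w1 \<in> slit_tangent_bundle A1"
    "(x, y) = snd (std_coords A1 c1) w1"
    by blast
  have "(u, v) \<in> snd (std_coords A2 c2) ` (fst (std_coords A2 c2) \<inter> slit_tangent_bundle A2)"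
    using x y by (simp add: std_coords_slit_image[OF M(2) c(2)])
  then obtain w2 where w2: "w2 \<in> fst (std_coords A2 c2)" "w2 \<in> slit_tangent_bundle A2"
    "(u, v) = snd (std_coords A2 c2) w2"
    by blast
  show ?thesis
    using w1 w2 by (intro image_eqI[of _ _ "(w1, w2)"]) (auto simp: prod_coords_def simp flip: w1(3) w2(3))
qed

section \<open>The equation of dual flatness under scaling of one fiber variable\<close>

text \<open>Here \<open>L\<close> stands for the squared warped metric, \<open>\<phi>\<close> and
  \<open>\<psi>\<close> for the squared warping functions, \<open>G\<close> and \<open>H\<close> for
  the squared metrics of the factors. Differentiating in a \<open>y\<close> direction removes the
  \<open>H\<close> term on the left, so a term quadratic in the scale of \<open>v\<close> arises
  only from the derivative of \<open>\<psi>\<close> on the right.\<close>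

lemma dually_flat_warping_derivative_zero:
  fixes L :: "('m::euclidean_space \<times> 'n::euclidean_space) \<times> ('m \<times> 'n) \<Rightarrow> real"
  assumes U: "open U" and V: "open V"
    and L: "\<And>x u y v. x \<in> U \<Longrightarrow> u \<in> V \<Longrightarrow> y \<noteq> 0 \<Longrightarrow> v \<noteq> 0 \<Longrightarrow>
      L ((x, u), (y, v)) = \<phi> u * G (x, y) + \<psi> x * H (u, v)"
    and G: "\<And>z. z \<in> U \<times> (- {0}) \<Longrightarrow> G differentiable (at z)"
    and \<psi>: "\<And>x. x \<in> U \<Longrightarrow> \<psi> differentiable (at x)"
    and H: "\<And>u v r. u \<in> V \<Longrightarrow> r > 0 \<Longrightarrow> H (u, r *\<^sub>R v) = r\<^sup>2 * H (u, v)"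
    and flat: "\<And>x u y v l. x \<in> U \<Longrightarrow> u \<in> V \<Longrightarrow> y \<noteq> 0 \<Longrightarrow> v \<noteq> 0 \<Longrightarrow> l \<in> Basis \<Longrightarrow>
      (\<Sum>k\<in>Basis. dx k (dy l L) ((x, u), (y, v)) * ((y, v) \<bullet> k)) = 2 * dx l L ((x, u), (y, v))"
    and x: "x \<in> U" and u: "u \<in> V" and v: "v \<noteq> 0" and i: "i \<in> Basis"
  shows "frechet_derivative \<psi> (at x) i * H (u, v) = 0"
proof -
  obtain y :: 'm where "y \<in> Basis"
    using nonempty_Basis by blast
  then have y: "y \<noteq> 0"
    using nonzero_Basis by blast
  \<comment> \<open>The formula for \<open>L\<close> is given on this set only; its openness allows
    differentiating the formula in place of \<open>L\<close>.\<close>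
  let ?D = "(U \<times> V) \<times> ((- {0}) \<times> (- {0})) :: (('m \<times> 'n) \<times> ('m \<times> 'n)) set"
  have D: "open ?D"
    using U V by (intro open_Times) auto
  have LD: "L z = \<phi> (snd (fst z)) * G (fst (fst z), fst (snd z)) +
      \<psi> (fst (fst z)) * H (snd (fst z), snd (snd z))" if "z \<in> ?D" for z
    using L[of "fst (fst z)" "snd (fst z)" "fst (snd z)" "snd (snd z)"] that by (simp add: mem_Times_iff)
  let ?L0 = "\<lambda>z :: ('m \<times> 'n) \<times> ('m \<times> 'n). \<phi> (snd (fst z)) * dy i G (fst (fst z), fst (snd z))"
  have dyL: "dy (i, 0) L z = ?L0 z" if z: "z \<in> ?D" for z
  proof -
    obtain x' u' y' v' where z': "z = ((x', u'), (y', v'))" "x' \<in> U" "u' \<in> V" "y' \<noteq> 0" "v' \<noteq> 0"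
      using z by auto
    have g: "((\<lambda>t. G ((x', y') + t *\<^sub>R (0, i))) has_field_derivative dy i G (x', y')) (at 0)"
      using has_field_derivative_along_line[OF G, of "(x', y')" "(0, i)"] z'
      by (simp add: dy_def DERIV_imp_deriv)
    have "dy (i, 0) L z = dy (i, 0) (\<lambda>z. \<phi> (snd (fst z)) * G (fst (fst z), fst (snd z)) +
        \<psi> (fst (fst z)) * H (snd (fst z), snd (snd z))) z"
      by (intro dy_cong[OF D z] LD)
    also have "\<dots> = deriv (\<lambda>t. \<phi> u' * G ((x', y') + t *\<^sub>R (0, i)) + \<psi> x' * H (u', v')) 0"
      by (simp add: dy_def z')
    also have "\<dots> = \<phi> u' * dy i G (x', y')"
      by (rule DERIV_imp_deriv) (auto intro!: derivative_eq_intros g[simplified])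
    finally show ?thesis
      by (simp add: z')
  qed
  \<comment> \<open>Only the independence of \<open>r\<close> matters: \<open>?L0\<close> does not
    involve \<open>v\<close>, so the value is the same at every \<open>r *\<^sub>R v\<close>,
    whatever \<open>deriv\<close> returns.\<close>
  define a where "a k = dx k ?L0 ((x, u), (y, v))" for k
  have dxdyL: "dx k (dy (i, 0) L) ((x, u), (y, r *\<^sub>R v)) = a k" if "r > 0" for k r
  proof -
    have "dx k (dy (i, 0) L) ((x, u), (y, r *\<^sub>R v)) = dx k ?L0 ((x, u), (y, r *\<^sub>R v))"
      using x u y v that by (intro dx_cong[OF D _ dyL]) auto
    also have "\<dots> = a k"
      unfolding a_def dx_def by simp
    finally show ?thesis .
  qed
  have il: "(i, 0) \<in> (Basis :: ('m \<times> 'n) set)"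
    using i by (simp add: Basis_prod_def)
  have g: "((\<lambda>t. G ((x, y) + t *\<^sub>R (i, 0))) has_field_derivative dx i G (x, y)) (at 0)"
    using has_field_derivative_along_line[OF G, of "(x, y)" "(i, 0)"] x y
    by (simp add: dx_def DERIV_imp_deriv)
  define e where "e = frechet_derivative \<psi> (at x) i"
  have \<psi>': "((\<lambda>t. \<psi> (x + t *\<^sub>R i)) has_field_derivative e) (at 0)"
    unfolding e_def by (rule has_field_derivative_along_line[OF \<psi>[OF x]])
  have dxL: "dx (i, 0) L ((x, u), (y, r *\<^sub>R v)) = \<phi> u * dx i G (x, y) + e * (r\<^sup>2 * H (u, v))"
    if r: "r > 0" for r
  proof -
    have "dx (i, 0) L ((x, u), (y, r *\<^sub>R v)) =
        dx (i, 0) (\<lambda>z. \<phi> (snd (fst z)) * G (fst (fst z), fst (snd z)) +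
          \<psi> (fst (fst z)) * H (snd (fst z), snd (snd z))) ((x, u), (y, r *\<^sub>R v))"
      using x u y v r by (intro dx_cong[OF D _ LD]) auto
    also have "\<dots> = deriv (\<lambda>t. \<phi> u * G ((x, y) + t *\<^sub>R (i, 0)) + \<psi> (x + t *\<^sub>R i) * H (u, r *\<^sub>R v)) 0"
      by (simp add: dx_def)
    also have "\<dots> = \<phi> u * dx i G (x, y) + e * H (u, r *\<^sub>R v)"
      by (rule DERIV_imp_deriv) (auto intro!: derivative_eq_intros g[simplified] \<psi>')
    finally show ?thesis
      using H[OF u r] by simp
  qed
  define p where "p = (\<Sum>k\<in>Basis. a k * ((y, 0) \<bullet> k))"
  define q where "q = (\<Sum>k\<in>Basis. a k * ((0, v) \<bullet> k))"
  \<comment> \<open>The coefficients \<open>a k\<close> are free of \<open>r\<close> and the fiber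
    vector \<open>(y, r *\<^sub>R v)\<close> is affine in \<open>r\<close>, so the left side is
    affine; homogeneity of \<open>H\<close> makes the right side quadratic.\<close>
  have quadratic: "p + r * q = 2 * (\<phi> u * dx i G (x, y) + e * (r\<^sup>2 * H (u, v)))" if r: "r > 0" for r
  proof -
    have split: "(y, r *\<^sub>R v) = (y, 0) + r *\<^sub>R (0, v)"
      by simp
    have "p + r * q = (\<Sum>k\<in>Basis. a k * ((y, r *\<^sub>R v) \<bullet> k))"
      unfolding p_def q_def split inner_add_left inner_scaleR_left
      by (simp add: sum_distrib_left algebra_simps sum.distrib)
    also have "\<dots> = 2 * dx (i, 0) L ((x, u), (y, r *\<^sub>R v))"
      using flat[OF x u y _ il, of "r *\<^sub>R v"] v r by (simp add: dxdyL)
    finally show ?thesis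
      using dxL[OF r] by simp
  qed
  have "p + r * q = 2 * (\<phi> u * dx i G (x, y)) + 2 * r\<^sup>2 * (e * H (u, v))" if "r > 0" for r
    using quadratic[OF that] by (simp add: algebra_simps)
  \<comment> \<open>The second difference over \<open>r\<close> = 1, 2, 3 annihilates the affine
    terms and leaves four times \<open>e * H (u, v)\<close>.\<close>
  from this[of 1] this[of 2] this[of 3] have "e * H (u, v) = 0"
    unfolding power2_eq_square by linarith
  then show ?thesis
    by (simp add: e_def)
qed

section \<open>From vanishing derivatives to global constancy\<close>

text \<open>A level set of a locally constant function is open and closed; in a connected space a
  nonempty one is everything.\<close>

lemma locally_constant_imp_constant_on:
  assumes X: "connected_space X"
    and loc: "\<And>p. p \<in> topspace X \<Longrightarrow> \<exists>W. openin X W \<and> p \<in> W \<and> (\<forall>q\<in>W. f q = f p)"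
  shows "f constant_on topspace X"
proof (cases "topspace X = {}")
  case False
  then obtain p where p: "p \<in> topspace X"
    by blast
  let ?S = "{q \<in> topspace X. f q = f p}"
  \<comment> \<open>An arbitrary predicate \<open>P\<close> covers both the level set and its
    complement.\<close>
  have "openin X {q \<in> topspace X. P (f q)}" for P
  proof (subst openin_subopen, intro ballI)
    fix q
    assume q: "q \<in> {q \<in> topspace X. P (f q)}"
    then obtain W where W: "openin X W" "q \<in> W" "\<forall>q'\<in>W. f q' = f q"
      using loc by blast
    have "P (f q')" if "q' \<in> W" for q'
      using W(3)[rule_format, OF that] q by simp
    then have "W \<subseteq> {q \<in> topspace X. P (f q)}"
      using openin_subset[OF W(1)] by blast
    then show "\<exists>T. openin X T \<and> q \<in> T \<and> T \<subseteq> {q \<in> topspace X. P (f q)}"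
      using W by blast
  qed
  note op = this
  have "topspace X - ?S = {q \<in> topspace X. f q \<noteq> f p}"
    by auto
  then have "closedin X ?S"
    using op[of "\<lambda>r. r \<noteq> f p"] by (auto simp: closedin_def)
  then have "?S = topspace X"
    using X op[of "\<lambda>r. r = f p"] p unfolding connected_space_clopen_in by blast
  then show ?thesis
    unfolding constant_on_def by blast
qed (simp add: constant_on_def)

text \<open>Euclidean spaces here have positive dimension, so a basis vector gives a nonzero
  component. Dual flatness, which is stated for tangent vectors, can thereby be applied at any base
  point.\<close>

lemma slit_tangent_vector_exists:
  fixes A :: "('a, 'e::euclidean_space) chart set"
  assumes M: "smooth_manifold X A" and p: "p \<in> topspace X"
  obtains w where "w \<in> slit_tangent_bundle A" "fst w = p"
proof -
  have "(\<Union>c\<in>A. fst c) = topspace X"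
    using M by (simp only: smooth_manifold_def)
  then obtain c where c: "c \<in> A" "p \<in> fst c"
    using p by blast
  obtain b :: 'e where "b \<in> Basis"
    using nonempty_Basis by blast
  then have "b \<noteq> 0"
    using nonzero_Basis by blast
  then have "tvec_of A c p b \<in> slit_tangent_bundle A"
    using slit_tangent_bundle_iff[OF M c(1), of "tvec_of A c p b"] c
    by (simp add: tvec_of_in_tangent_bundle[OF M c] snd_tvec_of[OF M c])
  then show thesis
    using that by simp
qed

theorem corollary10:
  fixes X1 :: "'a topology" and A1 :: "('a, 'm::euclidean_space) chart set"
    and F1 :: "('a, 'm) tvec \<Rightarrow> real" and f1 :: "'a \<Rightarrow> real"
    and X2 :: "'b topology" and A2 :: "('b, 'n::euclidean_space) chart set"
    and F2 :: "('b, 'n) tvec \<Rightarrow> real" and f2 :: "'b \<Rightarrow> real"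
  assumes "finsler_manifold X1 A1 F1" and "finsler_manifold X2 A2 F2"
    and "warping_function X1 A1 f1" and "warping_function X2 A2 f2"
    and "\<not> f1 constant_on topspace X1" and "\<not> f2 constant_on topspace X2"
  shows "\<not> locally_dually_flat
            (slit_tangent_bundle A1 \<times> slit_tangent_bundle A2)
            (dwp_std_coords A1 A2)
            (dwp_metric f2 F1 f1 F2)"
proof
  assume ldf: "locally_dually_flat (slit_tangent_bundle A1 \<times> slit_tangent_bundle A2)
    (dwp_std_coords A1 A2) (dwp_metric f2 F1 f1 F2)"
  have M: "smooth_manifold X1 A1" "smooth_manifold X2 A2"
    using assms(1,2) by (simp_all add: finsler_manifold_def)
  \<comment> \<open>Every function is constant on the empty set, so the second factor has a
    point.\<close>
  obtain q0 where q0: "q0 \<in> topspace X2"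
    using assms(6) by (auto simp: constant_on_def)
  obtain w2 where w2: "w2 \<in> slit_tangent_bundle A2" "fst w2 = q0"
    using slit_tangent_vector_exists[OF M(2) q0] .
  have "f1 constant_on topspace X1"
  proof (rule locally_constant_imp_constant_on)
    show "connected_space X1"
      using M by (simp add: smooth_manifold_def)
  next
    fix p
    assume p: "p \<in> topspace X1"
    obtain w1 where w1: "w1 \<in> slit_tangent_bundle A1" "fst w1 = p"
      using slit_tangent_vector_exists[OF M(1) p] .
    have "(w1, w2) \<in> slit_tangent_bundle A1 \<times> slit_tangent_bundle A2"
      using w1 w2 by simp
    then obtain s where s: "s \<in> dwp_std_coords A1 A2" "(w1, w2) \<in> fst s"
      and flat: "\<forall>z \<in> snd s ` (fst s \<inter> slit_tangent_bundle A1 \<times> slit_tangent_bundle A2). \<forall>l\<in>Basis.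
        (\<Sum>k\<in>Basis. dx k (dy l (\<lambda>z. (local_expr s (dwp_metric f2 F1 f1 F2) z)\<^sup>2)) z * (snd z \<bullet> k)) =
        2 * dx l (\<lambda>z. (local_expr s (dwp_metric f2 F1 f1 F2) z)\<^sup>2) z"
      using ldf unfolding locally_dually_flat_def Let_def by blast
    obtain c1 c2 where c: "c1 \<in> A1" "c2 \<in> A2"
      and seq: "s = prod_coords (std_coords A1 c1) (std_coords A2 c2)"
      using s by (auto simp: dwp_std_coords_def)
    have pc: "p \<in> fst c1" "q0 \<in> fst c2"
      using s w1 w2 by (auto simp: seq prod_coords_def fst_std_coords)
    have ch: "chart_of X1 c1" "chart_of X2 c2"
      using smooth_manifold_chart[OF M(1) c(1)] smooth_manifold_chart[OF M(2) c(2)] by auto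
    define U where "U = snd c1 ` fst c1"
    define V where "V = snd c2 ` fst c2"
    have oU: "open U" and oV: "open V"
      using ch by (auto simp: chart_of_def U_def V_def)
    define u where "u = snd c2 q0"
    have u: "u \<in> V"
      using pc by (simp add: u_def V_def)
    \<comment> \<open>With this \<open>v\<close> the factor \<open>H (u, v)\<close> can be
      cancelled, leaving the derivative of the squared warping function.\<close>
    obtain v where v: "v \<noteq> 0" "local_expr (std_coords A2 c2) F2 (u, v) \<noteq> 0"
      using finsler_local_nonzero[OF assms(2) c(2)] u unfolding V_def by blast
    let ?h = "f1 \<circ> chart_inv c1"
    have h: "?h differentiable (at x)" if "x \<in> U" for x
      using assms(3) c that
      by (auto simp: warping_function_def smooth_real_fun_def U_def intro: smooth_on_differentiable)
    have deriv0: "frechet_derivative ?h (at x) i = 0" if x: "x \<in> U" and i: "i \<in> Basis" for x i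
    proof -
      have "frechet_derivative (\<lambda>x. (?h x)\<^sup>2) (at x) i * (local_expr (std_coords A2 c2) F2 (u, v))\<^sup>2 = 0"
      proof (rule dually_flat_warping_derivative_zero[where
            L = "\<lambda>z. (local_expr s (dwp_metric f2 F1 f1 F2) z)\<^sup>2" and
            G = "\<lambda>z. (local_expr (std_coords A1 c1) F1 z)\<^sup>2" and
            H = "\<lambda>z. (local_expr (std_coords A2 c2) F2 z)\<^sup>2" and
            \<phi> = "\<lambda>u. (f2 (chart_inv c2 u))\<^sup>2" and U = U and V = V])
        fix x u and y :: 'm and v :: 'n
        assume "x \<in> U" "u \<in> V"
        then show "(local_expr s (dwp_metric f2 F1 f1 F2) ((x, u), (y, v)))\<^sup>2 =
          (f2 (chart_inv c2 u))\<^sup>2 * (local_expr (std_coords A1 c1) F1 (x, y))\<^sup>2 +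
          (?h x)\<^sup>2 * (local_expr (std_coords A2 c2) F2 (u, v))\<^sup>2"
          unfolding seq U_def V_def o_def by (rule local_expr_dwp[OF M c])
      next
        fix z :: "'m \<times> 'm"
        assume "z \<in> U \<times> (- {0})"
        then show "(\<lambda>z. (local_expr (std_coords A1 c1) F1 z)\<^sup>2) differentiable (at z)"
          using finsler_local_differentiable[OF assms(1) c(1)] unfolding U_def
          by (intro differentiable_power) auto
      next
        fix x
        assume "x \<in> U"
        then show "(\<lambda>x. (?h x)\<^sup>2) differentiable (at x)"
          using h by (intro differentiable_power)
      next
        fix u v and r :: real
        assume "u \<in> V" "r > 0"
        then show "(local_expr (std_coords A2 c2) F2 (u, r *\<^sub>R v))\<^sup>2 =
          r\<^sup>2 * (local_expr (std_coords A2 c2) F2 (u, v))\<^sup>2"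
          unfolding V_def by (simp add: local_expr_homogeneous[OF assms(2) c(2)] power_mult_distrib)
      next
        fix x u and y :: 'm and v :: 'n and l :: "'m \<times> 'n"
        assume xu: "x \<in> U" "u \<in> V" "y \<noteq> 0" "v \<noteq> 0" and l: "l \<in> Basis"
        have "((x, u), (y, v)) \<in> snd s ` (fst s \<inter> slit_tangent_bundle A1 \<times> slit_tangent_bundle A2)"
          using xu unfolding seq U_def V_def by (intro prod_coords_slit_image[OF M c])
        from bspec[OF bspec[OF flat this] l]
        show "(\<Sum>k\<in>Basis. dx k (dy l (\<lambda>z. (local_expr s (dwp_metric f2 F1 f1 F2) z)\<^sup>2)) ((x, u), (y, v)) *
            ((y, v) \<bullet> k)) = 2 * dx l (\<lambda>z. (local_expr s (dwp_metric f2 F1 f1 F2) z)\<^sup>2) ((x, u), (y, v))"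
          by simp
      qed (use oU oV x u v i in auto)
      then have 0: "frechet_derivative (\<lambda>x. (?h x)\<^sup>2) (at x) i = 0"
        using v by simp
      \<comment> \<open>Vanishing passes from the derivative of the square to that of
        \<open>?h\<close> itself, because warping functions are positive.\<close>
      have "((\<lambda>x. (?h x)\<^sup>2) has_derivative (\<lambda>y. 2 * ?h x * frechet_derivative ?h (at x) y)) (at x)"
        using h[OF x] unfolding frechet_derivative_works
        by (auto intro!: derivative_eq_intros simp: mult_ac simp del: o_apply)
      from frechet_derivative_at[OF this] have "2 * ?h x * frechet_derivative ?h (at x) i = 0"
        using 0 by metis
      moreover have "?h x > 0"
        using x assms(3) chart_subset[OF ch(1)]
        by (auto simp: U_def warping_function_def chart_inv_eq[OF ch(1)])
      ultimately show ?thesis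
        by simp
    qed
    have "snd c1 p \<in> U"
      using pc by (simp add: U_def)
    \<comment> \<open>The chart image \<open>U\<close> may be disconnected; on a ball, which is
      convex, a zero derivative does force constancy.\<close>
    then obtain e where e: "e > 0" "ball (snd c1 p) e \<subseteq> U"
      using oU by (auto simp: open_contains_ball)
    have "?h constant_on ball (snd c1 p) e"
      unfolding constant_on_def
    proof (rule has_derivative_zero_constant)
      show "convex (ball (snd c1 p) e)"
        by (rule convex_ball)
      fix x
      assume "x \<in> ball (snd c1 p) e"
      then have x: "x \<in> U"
        using e by blast
      have "linear (frechet_derivative ?h (at x))"
        using h[OF x] by (rule linear_frechet_derivative)
      \<comment> \<open>A linear map is determined by its values on the basis, and all of these are
        zero by \<open>deriv0\<close>.\<close>
      then have "frechet_derivative ?h (at x) = (\<lambda>_. 0)"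
        using deriv0[OF x] by (intro linear_eq_stdbasis) (auto simp: linear_iff)
      then show "(?h has_derivative (\<lambda>_. 0)) (at x within ball (snd c1 p) e)"
        using h[OF x] by (metis frechet_derivative_works has_derivative_at_withinI)
    qed
    then obtain a where a: "\<And>x. x \<in> ball (snd c1 p) e \<Longrightarrow> ?h x = a"
      by (auto simp: constant_on_def)
    have "f1 q = f1 p" if "q \<in> {q \<in> fst c1. snd c1 q \<in> ball (snd c1 p) e}" for q
      using a[of "snd c1 q"] a[of "snd c1 p"] that pc e by (simp add: chart_inv_eq[OF ch(1)])
    moreover have "p \<in> {q \<in> fst c1. snd c1 q \<in> ball (snd c1 p) e}"
      using pc e by simp
    ultimately show "\<exists>W. openin X1 W \<and> p \<in> W \<and> (\<forall>q\<in>W. f1 q = f1 p)"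
      using chart_preimage_open[OF ch(1) open_ball, of "snd c1 p" e] by blast
  qed
  then show False
    using assms(5) by contradiction
qed

end
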